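(* Let $T\in\mathcal D$ be a target concept and fix $r\in\mathbb N$. Suppose there exist $d\in\mathbb N$ and a map $G_d:[\Delta\times\{0,1\}]^d\to\mathcal D$ such that, for every $m\ge d+r$, writing $H_{I_d}=G_d\big(\{(\delta_i,\mathbf 1_T(\delta_i))\}_{i\in I_d}\big)$: (1) for all $I_r\in\mathcal I_r$ and all $I_d\in\mathcal I_d^{m-r}$, $H_{I_d}$ is consistent with $\{(\delta_i,\mathbf 1_T(\delta_i))\}_{i\in I_d}$; (2) with $\mathbb P^m$-probability one, for all $I_r\in\mathcal I_r$ there exists $I_d\in\mathcal I_d^{m-r}$ such that $H_{I_d}$ is consistent with $\{(\delta_i,\mathbf 1_T(\delta_i))\}_{i\in\{1,\ldots,m\}\setminus I_r}$; (3) with $\mathbb P^m$-probability one, there exists $I_r\in\mathcal I_r$ such that for any $I_d\in\mathcal I_d^{m-r}$ for which $H_{I_d}$ is consistent with $\{(\delta_i,\mathbf 1_T(\delta_i))\}_{i\in\{1,\ldots,m\}\setminus I_r}$, one has $\mathbf 1_{H_{I_d}}(\delta_i)\neq\mathbf 1_T(\delta_i)$ for all $i\in I_r$. Denote by $\bar I_r\in\mathcal I_r$ a set of indices as in (3), and let $\bar m_d^r$ be a map assigning to each labeled $m$-multisample a set of $d$ indices in $\{1,\dots,m\}\setminus\bar I_r$ such that $G_d\big(\{(\delta_i,\mathbf 1_T(\delta_i))\}_{i\in\bar m_d^r}\big)$ is consistent with $\{(\delta_i,\mathbf 1_T(\delta_i))\}_{i\in\{1,\ldots,m\}\setminus\bar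 I_r}$ and is not consistent with $(\delta_i,\mathbf 1_T(\delta_i))$ for all $i\in\bar I_r$ (i.e. it mislabels every $\delta_i$, $i\in\bar I_r$). Let $A_m\big(\{(\delta_i,\mathbf 1_T(\delta_i))\}_{i=1}^m\big)=H_m:=G_d\big(\{(\delta_i,\mathbf 1_T(\delta_i))\}_{i\in\bar m_d^r}\big)$. Then the algorithm $\{A_m\}_{m\ge d+r}$ is PAC-T with $q(m,\epsilon)=\binom md\sum_{i=0}^{r}\binom{m-d}{i}\epsilon^i(1-\epsilon)^{m-d-i}$, i.e. $\lim_{m\to\infty}q(m,\epsilon)=0$ for each $\epsilon\in(0,1)$ and, for any $\epsilon\in(0,1)$ and $m\ge d+r$, $$\mathbb P^m\Big\{(\delta_1,\ldots,\delta_m)\in\Delta^m:\ d_{\mathbb P}(T,H_m)>\epsilon\Big\}\le\binom md\sum_{i=0}^{r}\binom{m-d}{i}\epsilon^i(1-\epsilon)^{m-d-i}.$$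
   Context: $\Delta\subseteq\mathbb R^{n_\delta}$ is a set endowed with a $\sigma$-algebra $\mathcal D$, $\mathbb P$ is a probability measure on $\mathcal D$, and $\mathbb P^m$ is the product measure on $\Delta^m$ (so $\delta_1,\dots,\delta_m$ are i.i.d. with law $\mathbb P$). $\mathbb N$ denotes the positive integers. All involved sets are assumed measurable. Elements of $\mathcal D$ are called concepts or hypotheses; $T\in\mathcal D$ is a fixed target concept; $\mathbf 1_C$ is the indicator function of $C$. A labeled $m$-multisample is $\{(\delta_i,\mathbf 1_T(\delta_i))\}_{i=1}^m\in[\Delta\times\{0,1\}]^m$. For an index set $J$, a hypothesis $H\in\mathcal D$ is consistent with $\{(\delta_i,\mathbf 1_T(\delta_i))\}_{i\in J}$ iff $\mathbf 1_H(\delta_i)=\mathbf 1_T(\delta_i)$ for all $i\in J$. The error is $d_{\mathbb P}(T,H)=\mathbb P(\{\delta\in\Delta:\mathbf 1_H(\delta)\ne\mathbf 1_T(\delta)\})$. $\mathcal I_r$ is the set of all subsets of $\{1,\dots,m\}$ with $r$ elements. Given $I_r\in\mathcal I_r$, $\mathcal I_d^{m-r}$ is the set of all $\binom{m-r}{d}$ subsets $I_d$ of $\{1,\dots,m\}\setminus I_r$ with $d$ elements. When $G_d$ is applied to samples indexed by $I_d$, they are listed in increasing order of index. PAC-T: an algorithm is a family of maps $A_m:[\Delta\times\{0,1\}]^m\to\mathcal D$, $m\ge m_0$, and $H_m$ is the hypothesis returned by $A_m$ on the labeled $m$-multisample. It is PAC-T with $q(m,\epsilon)$ if for all $\epsilon\in(0,1)$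 and $m\ge m_0$, $\mathbb P^m\{d_{\mathbb P}(T,H_m)>\epsilon\}\le q(m,\epsilon)$, with $\lim_{m\to\infty}q(m,\epsilon)=0$ for each $\epsilon$. *)

theory Defs
  imports "HOL-Probability.Probability" "HOL-Library.Ramsey"
begin

text \<open>
  The underlying measure \<open>M\<close> packages the set of examples \<open>space M\<close>, its \<open>\<sigma>\<close>-algebra of
  concepts \<open>sets M\<close> and the probability. A multisample \<open>(\<delta>\<^sub>1, \<dots>, \<delta>\<^sub>m)\<close> is a point of
  \<open>mprod M m\<close>, that is, an extensional function on \<open>{1..m}\<close>.
\<close>

abbreviation mprod :: "'a measure \<Rightarrow> nat \<Rightarrow> (nat \<Rightarrow> 'a) measure" where
  "mprod M m \<equiv> PiM {1..m} (\<lambda>_. M)"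

text \<open>
  Labeled samples are lists, so that a map on \<open>k\<close>-samples may depend on the order of the
  sample. \<open>labeled T \<delta> J\<close> lists the labeled points with index in \<open>J\<close> by increasing index.
\<close>

definition samples :: "'a measure \<Rightarrow> nat \<Rightarrow> ('a \<times> nat) list set" where
  "samples M k = {zs. length zs = k \<and> set zs \<subseteq> space M \<times> {0, 1}}"

definition labeled :: "'a set \<Rightarrow> (nat \<Rightarrow> 'a) \<Rightarrow> nat set \<Rightarrow> ('a \<times> nat) list" where
  "labeled T \<delta> J = map (\<lambda>i. (\<delta> i, indicator T (\<delta> i))) (sorted_list_of_set J)"

definition consistent :: "'a set \<Rightarrow> ('a \<times> nat) list \<Rightarrow> bool" where
  "consistent H zs \<longleftrightarrow> (\<forall>(x, y) \<in> set zs. indicator H x = y)"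

definition mislabels :: "'a set \<Rightarrow> 'a set \<Rightarrow> 'a \<Rightarrow> bool" where
  "mislabels T H x \<longleftrightarrow> (indicator H x :: nat) \<noteq> indicator T x"

definition err :: "'a measure \<Rightarrow> 'a set \<Rightarrow> 'a set \<Rightarrow> real" where
  "err M T H = measure M {x \<in> space M. mislabels T H x}"

text \<open>
  An algorithm is \<open>PAC_T\<close> from the sample size \<open>m\<^sub>0\<close> on. Measurability of the failure event is
  demanded explicitly, because \<^const>\<open>measure\<close> is \<open>0\<close> on non-measurable sets.
\<close>

definition PAC_T ::
  "'a measure \<Rightarrow> 'a set \<Rightarrow> (nat \<Rightarrow> ('a \<times> nat) list \<Rightarrow> 'a set) \<Rightarrow> nat \<Rightarrow> (nat \<Rightarrow> real \<Rightarrow> real) \<Rightarrow> bool"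
where
  "PAC_T M T A m\<^sub>0 q \<longleftrightarrow>
     (\<forall>m\<ge>m\<^sub>0. A m \<in> samples M m \<rightarrow> sets M) \<and>
     (\<forall>\<epsilon>. 0 < \<epsilon> \<and> \<epsilon> < 1 \<longrightarrow>
        (\<forall>m\<ge>m\<^sub>0.
           {\<delta> \<in> space (mprod M m). err M T (A m (labeled T \<delta> {1..m})) > \<epsilon>} \<in> sets (mprod M m) \<and>
           measure (mprod M m)
             {\<delta> \<in> space (mprod M m). err M T (A m (labeled T \<delta> {1..m})) > \<epsilon>} \<le> q m \<epsilon>) \<and>
        (\<lambda>m. q m \<epsilon>) \<longlonglongrightarrow> 0)"

text \<open>
  \<open>removable G T d m \<delta> I\<close>: every hypothesis that \<open>G\<close> builds from \<open>d\<close> samples outside \<open>I\<close> and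
  that is consistent with all samples outside \<open>I\<close> mislabels every sample in \<open>I\<close>.
\<close>

definition removable ::
  "(('a \<times> nat) list \<Rightarrow> 'a set) \<Rightarrow> 'a set \<Rightarrow> nat \<Rightarrow> nat \<Rightarrow> (nat \<Rightarrow> 'a) \<Rightarrow> nat set \<Rightarrow> bool"
where
  "removable G T d m \<delta> I \<longleftrightarrow>
     (\<forall>J \<in> nsets ({1..m} - I) d.
        consistent (G (labeled T \<delta> J)) (labeled T \<delta> ({1..m} - I)) \<longrightarrow>
        (\<forall>i\<in>I. mislabels T (G (labeled T \<delta> J)) (\<delta> i)))"

text \<open>
  \<open>selects G T m \<delta> I J\<close>: the hypothesis built from the samples in \<open>J\<close> is consistent with the
  samples outside \<open>I\<close> and mislabels every sample in \<open>I\<close>.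
\<close>

definition selects ::
  "(('a \<times> nat) list \<Rightarrow> 'a set) \<Rightarrow> 'a set \<Rightarrow> nat \<Rightarrow> (nat \<Rightarrow> 'a) \<Rightarrow> nat set \<Rightarrow> nat set \<Rightarrow> bool"
where
  "selects G T m \<delta> I J \<longleftrightarrow>
     consistent (G (labeled T \<delta> J)) (labeled T \<delta> ({1..m} - I)) \<and>
     (\<forall>i\<in>I. mislabels T (G (labeled T \<delta> J)) (\<delta> i))"

text \<open>
  \<open>Ibar\<close> and \<open>mbar\<close> choose, for every labeled multisample of size at least \<open>d + r\<close>, disjoint sets
  of \<open>r\<close> and \<open>d\<close> indices. The defining properties of the two choices can be met almost surely
  only, hence each is required exactly for those multisamples for which it can be met.
\<close>

definition removal_choice ::
  "'a measure \<Rightarrow> 'a set \<Rightarrow> nat \<Rightarrow> nat \<Rightarrow> (('a \<times> nat) list \<Rightarrow> 'a set) \<Rightarrow>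
   (nat \<Rightarrow> ('a \<times> nat) list \<Rightarrow> nat set) \<Rightarrow> bool"
where
  "removal_choice M T r d G Ibar \<longleftrightarrow>
     (\<forall>m\<ge>d + r. \<forall>\<delta> \<in> space (mprod M m).
        Ibar m (labeled T \<delta> {1..m}) \<in> nsets {1..m} r \<and>
        ((\<exists>I \<in> nsets {1..m} r. removable G T d m \<delta> I) \<longrightarrow>
           removable G T d m \<delta> (Ibar m (labeled T \<delta> {1..m}))))"

definition compression_choice ::
  "'a measure \<Rightarrow> 'a set \<Rightarrow> nat \<Rightarrow> nat \<Rightarrow> (('a \<times> nat) list \<Rightarrow> 'a set) \<Rightarrow>
   (nat \<Rightarrow> ('a \<times> nat) list \<Rightarrow> nat set) \<Rightarrow> (nat \<Rightarrow> ('a \<times> nat) list \<Rightarrow> nat set) \<Rightarrow> bool"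
where
  "compression_choice M T r d G Ibar mbar \<longleftrightarrow>
     (\<forall>m\<ge>d + r. \<forall>\<delta> \<in> space (mprod M m).
        let z = labeled T \<delta> {1..m} in
        mbar m z \<in> nsets ({1..m} - Ibar m z) d \<and>
        ((\<exists>J \<in> nsets ({1..m} - Ibar m z) d. selects G T m \<delta> (Ibar m z) J) \<longrightarrow>
           selects G T m \<delta> (Ibar m z) (mbar m z)))"

end

theory Submission
  imports Defs
begin

text \<open>
  Almost surely the selected hypothesis mislabels only points of the removed set, so at most \<open>r\<close>
  of the \<open>m - d\<close> points outside the compression set \<open>J\<close>. For a fixed \<open>J\<close>, conditionally on the
  points indexed by \<open>J\<close>, the mislabeled points outside \<open>J\<close> are independent trials with success
  probability equal to the error of the hypothesis. If this error exceeds \<open>\<epsilon>\<close>, the probability of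
  at most \<open>r\<close> successes is at most the binomial tail with parameter \<open>\<epsilon>\<close>. A union bound over the
  \<open>m choose d\<close> sets \<open>J\<close> concludes.
\<close>

subsection \<open>The binomial tail\<close>

text \<open>This is the probability of fewer than \<open>k\<close> successes in \<open>n\<close>
  independent trials with success probability \<open>p\<close>. The strict bound lets recursions
  start from the value 0 at \<open>k = 0\<close>; "at most \<open>r\<close>" becomes
  \<open>Suc r\<close>.\<close>

definition binom_tail :: "nat \<Rightarrow> nat \<Rightarrow> real \<Rightarrow> real" where
  "binom_tail n k p = (\<Sum>i<k. real (n choose i) * p ^ i * (1 - p) ^ (n - i))"

lemma binom_tail_0_right [simp]: "binom_tail n 0 p = 0"
  by (simp add: binom_tail_def)

lemma binom_tail_0_left [simp]: "binom_tail 0 (Suc k) p = 1"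
proof -
  have "binom_tail 0 (Suc k) p = (\<Sum>i<Suc k. if i = 0 then 1 else 0)"
    unfolding binom_tail_def by (intro sum.cong) auto
  then show ?thesis
    by simp
qed

lemma binom_tail_nonneg: "0 \<le> p \<Longrightarrow> p \<le> 1 \<Longrightarrow> 0 \<le> binom_tail n k p"
  unfolding binom_tail_def by (intro sum_nonneg mult_nonneg_nonneg) auto

text \<open>Condition on one trial: a success lowers the number of successes still allowed by one, a
  failure leaves it unchanged.\<close>

lemma binom_tail_Suc:
  "binom_tail (Suc n) (Suc k) p = p * binom_tail n k p + (1 - p) * binom_tail n (Suc k) p"
proof (induction k)
  case 0
  then show ?case
    by (simp add: binom_tail_def)
next
  case (Suc k)
  \<comment> \<open>For \<open>Suc k > n\<close> truncated subtraction spoils the exponents, but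
    then the binomial coefficient is 0.\<close>
  have *: "real (n choose Suc k) * (1 - p) ^ (n - k) =
      real (n choose Suc k) * ((1 - p) * (1 - p) ^ (n - Suc k))"
    by (cases "Suc k \<le> n") (simp_all add: binomial_eq_0 Suc_diff_Suc flip: power_Suc)
  have step: "binom_tail l (Suc j) p = binom_tail l j p + real (l choose j) * p ^ j * (1 - p) ^ (l - j)" for l j
    by (simp add: binom_tail_def)
  \<comment> \<open>Split off the top term, apply the induction hypothesis to the rest and Pascal's
    rule to the coefficient of the top term.\<close>
  have "binom_tail (Suc n) (Suc (Suc k)) p =
      p * binom_tail n k p + (1 - p) * binom_tail n (Suc k) p
      + (real (n choose k) + real (n choose Suc k)) * p ^ Suc k * (1 - p) ^ (n - k)"
    by (subst step) (simp add: Suc.IH)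
  also have "\<dots> = p * (binom_tail n k p + real (n choose k) * p ^ k * (1 - p) ^ (n - k))
      + (1 - p) * binom_tail n (Suc k) p + p ^ Suc k * (real (n choose Suc k) * (1 - p) ^ (n - k))"
    by (simp add: algebra_simps)
  also have "\<dots> = p * binom_tail n (Suc k) p + (1 - p) * binom_tail n (Suc (Suc k)) p"
    unfolding * step[of n k] step[of n "Suc k"] by (simp add: algebra_simps)
  finally show ?case .
qed

section \<open>Decay of the bound as the sample grows\<close>

lemma power_mult_power_tendsto_0:
  fixes x :: real
  assumes "0 < x" "x < 1"
  shows "(\<lambda>n. real n ^ k * x ^ n) \<longlonglongrightarrow> 0"
proof (cases "k = 0")
  case True
  then show ?thesis
    using assms by (simp add: LIMSEQ_power_zero)
next
  case False
  \<comment> \<open>With a \<open>k\<close>-th root \<open>y\<close> of \<open>x\<close>, the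
    sequence is the \<open>k\<close>-th power of \<open>n * y ^ n\<close>, whose limit is known to
    be 0.\<close>
  define y where "y = root k x"
  have y: "0 < y" "y < 1" "y ^ k = x"
    using assms False by (auto simp: y_def)
  have "(\<lambda>n. (of_nat n * y ^ n) ^ k) \<longlonglongrightarrow> 0 ^ k"
    using y by (intro tendsto_power powser_times_n_limit_0) auto
  moreover have "(real n * y ^ n) ^ k = real n ^ k * x ^ n" for n
    by (simp add: power_mult_distrib flip: y(3)) (simp add: power_mult[symmetric] mult.commute)
  ultimately show ?thesis
    using False by (simp add: power_0_left)
qed

lemma choose_mult_binom_tail_tendsto_0:
  fixes p :: real
  assumes "0 < p" "p < 1"
  shows "(\<lambda>m. real (m choose d) * binom_tail (m - d) k p) \<longlonglongrightarrow> 0"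
proof -
  \<comment> \<open>The number of summands is fixed, and each is at most a polynomial in
    \<open>m\<close> times \<open>(1 - p) ^ m\<close>. The constant \<open>?c i\<close> pays for
    replacing the exponent \<open>m - d - i\<close> by \<open>m\<close>.\<close>
  let ?c = "\<lambda>i. 1 / (1 - p) ^ (d + i)"
  have choose_le: "real (n choose i) \<le> real n ^ i" for n i
  proof -
    have "(n choose i) * 1 \<le> (n choose i) * fact i"
      by (intro mult_le_mono) auto
    also have "\<dots> \<le> n ^ i"
      by (rule binomial_fact_pow)
    finally show ?thesis
      by (simp flip: of_nat_power)
  qed
  have term_le: "real (m choose d) * (real ((m - d) choose i) * p ^ i * (1 - p) ^ (m - d - i))
      \<le> ?c i * (real m ^ (d + i) * (1 - p) ^ m)" for m i
  proof (cases "d + i \<le> m")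
    case True
    have "real (m choose d) * (real ((m - d) choose i) * p ^ i * (1 - p) ^ (m - d - i))
        \<le> real m ^ d * (real m ^ i * 1 * (1 - p) ^ (m - d - i))"
      using assms True
      by (intro mult_mono mult_nonneg_nonneg power_le_one choose_le order_trans[OF choose_le] power_mono) auto
    also have "\<dots> = ?c i * (real m ^ (d + i) * (1 - p) ^ m)"
      using assms True by (simp add: power_diff power_add)
    finally show ?thesis .
  next
    \<comment> \<open>Here the exponent is truncated, but one of the two binomial coefficients
      vanishes.\<close>
    case False
    then have "m < d \<or> m - d < i"
      by auto
    then show ?thesis
      using assms by (auto simp: binomial_eq_0)
  qed
  have "(\<lambda>m. \<Sum>i<k. ?c i * (real m ^ (d + i) * (1 - p) ^ m)) \<longlonglongrightarrow> (\<Sum>i<k. ?c i * 0)"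
    using assms by (intro tendsto_sum tendsto_mult_left power_mult_power_tendsto_0) auto
  then have lim: "(\<lambda>m. \<Sum>i<k. ?c i * (real m ^ (d + i) * (1 - p) ^ m)) \<longlonglongrightarrow> 0"
    by simp
  show ?thesis
  proof (rule tendsto_sandwich[OF _ _ tendsto_const lim])
    show "\<forall>\<^sub>F m in sequentially. 0 \<le> real (m choose d) * binom_tail (m - d) k p"
      using assms by (intro always_eventually allI mult_nonneg_nonneg binom_tail_nonneg) auto
    show "\<forall>\<^sub>F m in sequentially. real (m choose d) * binom_tail (m - d) k p
        \<le> (\<Sum>i<k. ?c i * (real m ^ (d + i) * (1 - p) ^ m))"
      unfolding binom_tail_def sum_distrib_left
      by (intro always_eventually allI sum_mono term_le)
  qed
qed

subsection \<open>Counting hits of an event in an i.i.d. sample\<close>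

context prob_space
begin

lemma product_prob_space_const: "product_prob_space (\<lambda>_. M)"
  by unfold_locales

text \<open>The number of hits is binomial with parameter \<open>prob E\<close>, and a larger
  success probability makes few hits less likely. The induction integrates out one coordinate and
  compares with \<open>p\<close> at once, so monotonicity of \<open>binom_tail\<close> in
  \<open>p\<close> is not a separate step.\<close>

lemma measure_PiM_card_less_le_binom_tail:
  fixes I :: "nat set"
  assumes "finite I" and E: "E \<in> events" and p: "0 \<le> p" "p \<le> prob E"
  shows "measure (PiM I (\<lambda>_. M)) {x \<in> space (PiM I (\<lambda>_. M)). card {i \<in> I. x i \<in> E} < k}
    \<le> binom_tail (card I) k p"
  using \<open>finite I\<close>
proof (induction I arbitrary: k rule: finite_induct)
  case empty
  show ?case
    by (cases k) (auto intro!: prob_space.prob_le_1 prob_space_PiM prob_space_axioms)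
next
  case (insert i I)
  interpret P: product_prob_space "\<lambda>_. M"
    by (rule product_prob_space_const)
  have p1: "p \<le> 1"
    using p prob_le_1[of E] by linarith
  show ?case
  proof (cases k)
    case 0
    then show ?thesis
      by simp
  next
    case (Suc k')
    define B where "B J l = {x \<in> space (PiM J (\<lambda>_. M)). card {i \<in> J. x i \<in> E} < l}" for J :: "nat set" and l
    have B_meas [measurable]: "B J l \<in> sets (PiM J (\<lambda>_. M))" if "finite J" for J l
    proof -
      have [measurable]: "{x \<in> space (PiM J (\<lambda>_. M)). j \<in> {i \<in> J. x i \<in> E}} \<in> sets (PiM J (\<lambda>_. M))" for j
        using E by (cases "j \<in> J") auto
      show ?thesis
        unfolding B_def by measurable
    qed
    have fin: "finite {j \<in> I. x j \<in> E}" for x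
      using insert.hyps by simp
    \<comment> \<open>Once the new coordinate is fixed, a hit in \<open>E\<close> uses up one of the
      permitted hits.\<close>
    have upd: "x(i := y) \<in> B (insert i I) k \<longleftrightarrow> x \<in> B I (if y \<in> E then k' else k)"
      if "y \<in> space M" "x \<in> space (PiM I (\<lambda>_. M))" for x y
    proof -
      have "{j \<in> insert i I. (x(i := y)) j \<in> E} = (if y \<in> E then insert i {j \<in> I. x j \<in> E} else {j \<in> I. x j \<in> E})"
        using insert.hyps by auto
      moreover have "x(i := y) \<in> space (PiM (insert i I) (\<lambda>_. M))"
        using that by (auto simp: space_PiM PiE_iff extensional_def)
      ultimately show ?thesis
        using that(2) insert.hyps fin unfolding B_def by (simp add: Suc)
    qed
    interpret PI: prob_space "PiM I (\<lambda>_. M)"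
      by (intro prob_space_PiM prob_space_axioms)
    interpret PII: prob_space "PiM (insert i I) (\<lambda>_. M)"
      by (intro prob_space_PiM prob_space_axioms)
    let ?a = "PI.prob (B I k')" and ?b = "PI.prob (B I k)"
    have "emeasure (PiM (insert i I) (\<lambda>_. M)) (B (insert i I) k)
        = (\<integral>\<^sup>+ y. (\<integral>\<^sup>+ x. indicator (B (insert i I) k) (x(i := y)) \<partial>PiM I (\<lambda>_. M)) \<partial>M)"
      using insert.hyps
      by (subst P.product_nn_integral_insert_rev[symmetric]) (auto intro: B_meas)
    also have "\<dots> = (\<integral>\<^sup>+ y. (\<integral>\<^sup>+ x. indicator (B I (if y \<in> E then k' else k)) x \<partial>PiM I (\<lambda>_. M)) \<partial>M)"
      by (intro nn_integral_cong) (auto simp: indicator_def upd)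
    also have "\<dots> = (\<integral>\<^sup>+ y. ennreal ?a * indicator E y + ennreal ?b * indicator (space M - E) y \<partial>M)"
      using insert.hyps
      by (intro nn_integral_cong) (auto simp: PI.emeasure_eq_measure B_meas)
    also have "\<dots> = ennreal ?a * ennreal (prob E) + ennreal ?b * ennreal (1 - prob E)"
      using E by (simp add: nn_integral_add nn_integral_cmult emeasure_eq_measure prob_compl)
    also have "\<dots> = ennreal (?a * prob E + ?b * (1 - prob E))"
      by (simp add: ennreal_mult ennreal_plus)
    finally have eq: "PII.prob (B (insert i I) k) = ?a * prob E + ?b * (1 - prob E)"
      by (simp add: PII.emeasure_eq_measure ennreal_inj del: ennreal_plus)
    \<comment> \<open>The exact probability is an average of \<open>?a\<close> and
      \<open>?b\<close>. Lowering the weight of \<open>?a\<close> from \<open>prob E\<close> to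
      \<open>p\<close> moves mass to the larger value \<open>?b\<close>, so the average can only
      grow.\<close>
    have "?a \<le> ?b"
      using insert.hyps by (intro PI.finite_measure_mono B_meas) (auto simp: B_def Suc)
    then have "0 \<le> (?b - ?a) * (prob E - p)"
      using p by simp
    then have "PII.prob (B (insert i I) k) \<le> p * ?a + (1 - p) * ?b"
      unfolding eq by (simp add: algebra_simps)
    also have "\<dots> \<le> p * binom_tail (card I) k' p + (1 - p) * binom_tail (card I) k p"
      using insert.IH p p1 by (intro add_mono mult_left_mono) (auto simp: B_def)
    also have "\<dots> = binom_tail (card (insert i I)) k p"
      using insert.hyps by (simp add: binom_tail_Suc Suc)
    finally show ?thesis
      by (simp add: B_def)
  qed
qed

text \<open>Averaging over a coordinate on which \<open>C\<close> does not depend turns \<open>x i \<in> C x\<close> into \<open>prob (C x)\<close>.\<close>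

lemma borel_measurable_prob_of_mem:
  assumes i: "i \<in> I" and sub: "\<And>x. x \<in> space (PiM I (\<lambda>_. M)) \<Longrightarrow> C x \<subseteq> space M"
    and meas: "{x \<in> space (PiM I (\<lambda>_. M)). x i \<in> C x} \<in> sets (PiM I (\<lambda>_. M))" (is "?S \<in> _")
    and indep: "\<And>x y. C (x(i := y)) = C x"
  shows "(\<lambda>x. prob (C x)) \<in> borel_measurable (PiM I (\<lambda>_. M))"
proof -
  let ?P = "PiM I (\<lambda>_. M)"
  \<comment> \<open>Resampling coordinate \<open>i\<close> is measurable. The section at
    \<open>x\<close> of the pulled-back set is exactly \<open>C x\<close>, since \<open>C\<close>
    ignores that coordinate, and measures of sections are measurable.\<close>
  have f: "(\<lambda>(x, y). x(i := y)) \<in> ?P \<Otimes>\<^sub>M M \<rightarrow>\<^sub>M ?P"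
    using measurable_add_dim[of i I "\<lambda>_. M"] i by (simp add: insert_absorb)
  let ?Q = "(\<lambda>(x, y). x(i := y)) -` ?S \<inter> space (?P \<Otimes>\<^sub>M M)"
  have Q: "?Q \<in> sets (?P \<Otimes>\<^sub>M M)"
    using measurable_sets[OF f meas] .
  have "Pair x -` ?Q = C x" if x: "x \<in> space ?P" for x
  proof -
    have "x(i := y) \<in> space ?P" if "y \<in> space M" for y
      using x that i by (auto simp: space_PiM PiE_iff extensional_def)
    then show ?thesis
      using x sub[OF x] by (auto simp: space_pair_measure indep)
  qed
  then have "(\<lambda>x. measure M (Pair x -` ?Q)) \<in> borel_measurable ?P \<longleftrightarrow> ?thesis"
    by (intro measurable_cong) simp
  moreover have "(\<lambda>x. measure M (Pair x -` ?Q)) \<in> borel_measurable ?P"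
    unfolding measure_def using measurable_emeasure_Pair[OF Q] by measurable
  ultimately show ?thesis
    by simp
qed

text \<open>By Fubini, fix the coordinates in \<open>J\<close> first. The random set
  \<open>C x\<close> then becomes a fixed event, while the coordinates in \<open>K\<close> remain
  i.i.d., so the bound for a fixed event applies to the inner integral.\<close>

lemma measure_PiM_few_hits_le_binom_tail:
  fixes J K :: "nat set"
  assumes fin: "finite J" "finite K" and disj: "J \<inter> K = {}" and p: "0 \<le> p" "p \<le> 1"
    and C: "\<And>x. x \<in> space (PiM (J \<union> K) (\<lambda>_. M)) \<Longrightarrow> C x \<in> events"
    and dep: "\<And>x y. (\<And>j. j \<in> J \<Longrightarrow> x j = y j) \<Longrightarrow> C x = C y"
    and meas: "{x \<in> space (PiM (J \<union> K) (\<lambda>_. M)). p < prob (C x) \<and> card {i \<in> K. x i \<in> C x} < k}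
      \<in> sets (PiM (J \<union> K) (\<lambda>_. M))" (is "?B \<in> _")
  shows "measure (PiM (J \<union> K) (\<lambda>_. M)) ?B \<le> binom_tail (card K) k p"
proof -
  interpret P: product_prob_space "\<lambda>_. M"
    by (rule product_prob_space_const)
  interpret PJ: prob_space "PiM J (\<lambda>_. M)"
    by (intro prob_space_PiM prob_space_axioms)
  interpret PK: prob_space "PiM K (\<lambda>_. M)"
    by (intro prob_space_PiM prob_space_axioms)
  interpret PJK: prob_space "PiM (J \<union> K) (\<lambda>_. M)"
    by (intro prob_space_PiM prob_space_axioms)
  have tail: "0 \<le> binom_tail (card K) k p"
    using p by (rule binom_tail_nonneg)
  have inner: "(\<integral>\<^sup>+ y. indicator ?B (merge J K (x, y)) \<partial>PiM K (\<lambda>_. M)) \<le> ennreal (binom_tail (card K) k p)"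
    if x: "x \<in> space (PiM J (\<lambda>_. M))" for x
  proof -
    have Cm: "C (merge J K (x, y)) = C x" for y
      by (rule dep) (simp add: merge_def)
    have K: "{i \<in> K. merge J K (x, y) i \<in> C x} = {i \<in> K. y i \<in> C x}" for y
      using disj by (auto simp: merge_def)
    have sp: "merge J K (x, y) \<in> space (PiM (J \<union> K) (\<lambda>_. M))" if "y \<in> space (PiM K (\<lambda>_. M))" for y
      using x that disj by (auto simp: space_PiM PiE_iff merge_def extensional_def)
    \<comment> \<open>Membership of \<open>C\<close> in the events is known only at points of the
      full product; any \<open>y0\<close> completes \<open>x\<close> to such a point without
      changing \<open>C\<close>.\<close>
    obtain y0 where "y0 \<in> space (PiM K (\<lambda>_. M))"
      using PK.not_empty by blast
    then have Cx: "C x \<in> events"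
      using C[OF sp] by (simp add: Cm)
    have "(\<integral>\<^sup>+ y. indicator ?B (merge J K (x, y)) \<partial>PiM K (\<lambda>_. M))
        = (\<integral>\<^sup>+ y. indicator {y \<in> space (PiM K (\<lambda>_. M)). p < prob (C x) \<and> card {i \<in> K. y i \<in> C x} < k} y
            \<partial>PiM K (\<lambda>_. M))"
      by (intro nn_integral_cong) (auto simp: indicator_def Cm K sp)
    also have "\<dots> \<le> ennreal (binom_tail (card K) k p)"
    \<comment> \<open>If the probability does not exceed \<open>p\<close>, the inner set is empty
      and only nonnegativity of the bound is needed.\<close>
    proof (cases "p < prob (C x)")
      case True
      have m: "{y \<in> space (PiM K (\<lambda>_. M)). i \<in> {j \<in> K. y j \<in> C x}} \<in> sets (PiM K (\<lambda>_. M))" for i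
        using Cx by (cases "i \<in> K") auto
      have "{y \<in> space (PiM K (\<lambda>_. M)). card {i \<in> K. y i \<in> C x} < k} \<in> sets (PiM K (\<lambda>_. M))"
        using measurable_card[OF m] by measurable
      then show ?thesis
        using True measure_PiM_card_less_le_binom_tail[OF fin(2) Cx p(1), of k]
        by (simp add: PK.emeasure_eq_measure ennreal_leI)
    qed (simp add: tail)
    finally show ?thesis .
  qed
  have "emeasure (PiM (J \<union> K) (\<lambda>_. M)) ?B
      = (\<integral>\<^sup>+ x. (\<integral>\<^sup>+ y. indicator ?B (merge J K (x, y)) \<partial>PiM K (\<lambda>_. M)) \<partial>PiM J (\<lambda>_. M))"
    using meas by (subst P.product_nn_integral_fold[OF disj fin, symmetric]) auto
  also have "\<dots> \<le> (\<integral>\<^sup>+ x. ennreal (binom_tail (card K) k p) \<partial>PiM J (\<lambda>_. M))"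
    by (intro nn_integral_mono inner)
  also have "\<dots> = ennreal (binom_tail (card K) k p)"
    by (simp add: PJ.emeasure_space_1)
  finally show ?thesis
    using tail by (simp add: PJK.emeasure_eq_measure)
qed

end

subsection \<open>Labeled samples\<close>

lemma labeled_in_samples:
  assumes "\<delta> \<in> space (mprod M m)" "J \<in> nsets {1..m} d"
  shows "labeled T \<delta> J \<in> samples M d"
  using assms by (auto simp: labeled_def samples_def nsets_def space_PiM PiE_iff indicator_def)

lemma labeled_cong:
  assumes "finite J" "\<And>j. j \<in> J \<Longrightarrow> \<delta> j = \<delta>' j"
  shows "labeled T \<delta> J = labeled T \<delta>' J"
  using assms by (auto simp: labeled_def)

lemma consistent_labeled_iff:
  "finite J \<Longrightarrow> consistent H (labeled T \<delta> J) \<longleftrightarrow> (\<forall>i\<in>J. \<not> mislabels T H (\<delta> i))"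
  by (auto simp: consistent_def labeled_def mislabels_def)

lemma sets_mislabels:
  assumes "T \<in> sets M" "H \<in> sets M"
  shows "{x \<in> space M. mislabels T H x} \<in> sets M"
proof -
  have "{x \<in> space M. mislabels T H x} = (T - H) \<union> (H - T)"
    using assms[THEN sets.sets_into_space] by (auto simp: mislabels_def indicator_def)
  then show ?thesis
    using assms by auto
qed

section \<open>Failure probability of the compression algorithm\<close>

theorem theorem4:
  fixes M :: "(real ^ 'n) measure"
    and T :: "(real ^ 'n) set"
    and r d :: nat
    and G :: "((real ^ 'n) \<times> nat) list \<Rightarrow> (real ^ 'n) set"
    and Ibar mbar :: "nat \<Rightarrow> ((real ^ 'n) \<times> nat) list \<Rightarrow> nat set"
    and A :: "nat \<Rightarrow> ((real ^ 'n) \<times> nat) list \<Rightarrow> (real ^ 'n) set"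
  assumes prob: "prob_space M"
    and T: "T \<in> sets M"
    and r: "r \<ge> 1" and d: "d \<ge> 1"
    and G: "G \<in> samples M d \<rightarrow> sets M"
    and cond1: "\<And>m \<delta> I J. m \<ge> d + r \<Longrightarrow> \<delta> \<in> space (mprod M m) \<Longrightarrow>
           I \<in> nsets {1..m} r \<Longrightarrow> J \<in> nsets ({1..m} - I) d \<Longrightarrow>
           consistent (G (labeled T \<delta> J)) (labeled T \<delta> J)"
    and cond2: "\<And>m. m \<ge> d + r \<Longrightarrow>
           AE \<delta> in mprod M m. \<forall>I \<in> nsets {1..m} r. \<exists>J \<in> nsets ({1..m} - I) d.
             consistent (G (labeled T \<delta> J)) (labeled T \<delta> ({1..m} - I))"
    and cond3: "\<And>m. m \<ge> d + r \<Longrightarrow>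
           AE \<delta> in mprod M m. \<exists>I \<in> nsets {1..m} r. removable G T d m \<delta> I"
    and Ibar: "removal_choice M T r d G Ibar"
    and mbar: "compression_choice M T r d G Ibar mbar"
    and A: "\<And>m. m \<ge> d + r \<Longrightarrow> A m \<in> samples M m \<rightarrow> sets M"
    and A_eq: "\<And>m \<delta>. m \<ge> d + r \<Longrightarrow> \<delta> \<in> space (mprod M m) \<Longrightarrow>
           A m (labeled T \<delta> {1..m}) = G (labeled T \<delta> (mbar m (labeled T \<delta> {1..m})))"
    and meas_mislabeled: "\<And>m J i. m \<ge> d + r \<Longrightarrow> J \<in> nsets {1..m} d \<Longrightarrow> i \<in> {1..m} \<Longrightarrow>
           {\<delta> \<in> space (mprod M m). mislabels T (G (labeled T \<delta> J)) (\<delta> i)} \<in> sets (mprod M m)"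
    and meas_failure: "\<And>m \<epsilon>. m \<ge> d + r \<Longrightarrow> 0 < \<epsilon> \<Longrightarrow> \<epsilon> < 1 \<Longrightarrow>
           {\<delta> \<in> space (mprod M m). err M T (A m (labeled T \<delta> {1..m})) > \<epsilon>} \<in> sets (mprod M m)"
  shows "PAC_T M T A (d + r)
           (\<lambda>m \<epsilon>. real (m choose d) *
              (\<Sum>i=0..r. real ((m - d) choose i) * \<epsilon> ^ i * (1 - \<epsilon>) ^ (m - d - i)))"
proof -
  interpret prob_space M
    by (rule prob)
  \<comment> \<open>\<open>C J\<close> is the error region of the hypothesis built from
    \<open>J\<close>, so its probability is the error. \<open>B m \<epsilon> J\<close> is the bad
    event for a fixed \<open>J\<close>: the error exceeds \<epsilon>, yet at most \<open>r\<close>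
    of the points outside \<open>J\<close> reveal it.\<close>
  define C where "C J \<delta> = {x \<in> space M. mislabels T (G (labeled T \<delta> J)) x}" for J \<delta>
  define B where "B m \<epsilon> J = {\<delta> \<in> space (mprod M m).
      \<epsilon> < prob (C J \<delta>) \<and> card {i \<in> {1..m} - J. \<delta> i \<in> C J \<delta>} < Suc r}" for m \<epsilon> J
  have q_eq: "(\<Sum>i=0..r. real ((m - d) choose i) * \<epsilon> ^ i * (1 - \<epsilon>) ^ (m - d - i)) = binom_tail (m - d) (Suc r) \<epsilon>"
    for m \<epsilon>
    unfolding binom_tail_def by (intro sum.cong) auto
  have C_iff: "\<delta> i \<in> C J \<delta> \<longleftrightarrow> mislabels T (G (labeled T \<delta> J)) (\<delta> i)"
    if "\<delta> \<in> space (mprod M m)" "i \<in> {1..m}" for \<delta> i J m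
    using that by (auto simp: C_def space_PiM)
  have C_cong: "C J \<delta> = C J \<delta>'" if "finite J" "\<And>j. j \<in> J \<Longrightarrow> \<delta> j = \<delta>' j" for J \<delta> \<delta>'
    unfolding C_def by (simp add: labeled_cong[OF that])

  have B_sets: "B m \<epsilon> J \<in> sets (mprod M m)" and B_le: "measure (mprod M m) (B m \<epsilon> J) \<le> binom_tail (m - d) (Suc r) \<epsilon>"
    if m: "m \<ge> d + r" and J: "J \<in> nsets {1..m} d" and \<epsilon>: "0 < \<epsilon>" "\<epsilon> < 1" for m \<epsilon> J
  proof -
    define K where "K = {1..m} - J"
    have J': "J \<subseteq> {1..m}" "finite J" "card J = d"
      using J by (auto simp: nsets_def)
    then have cardK: "card K = m - d" and JK: "J \<union> K = {1..m}" "J \<inter> K = {}" "finite K"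
      by (auto simp: K_def card_Diff_subset)
    have hit: "{\<delta> \<in> space (mprod M m). \<delta> i \<in> C J \<delta>} \<in> sets (mprod M m)" if "i \<in> {1..m}" for i
    proof -
      have "{\<delta> \<in> space (mprod M m). \<delta> i \<in> C J \<delta>}
          = {\<delta> \<in> space (mprod M m). mislabels T (G (labeled T \<delta> J)) (\<delta> i)}"
        using that by (auto simp: C_iff)
      then show ?thesis
        using meas_mislabeled[OF m J that] by simp
    qed
    have hits: "{\<delta> \<in> space (mprod M m). i \<in> {j \<in> K. \<delta> j \<in> C J \<delta>}} \<in> sets (mprod M m)" for i
      using hit by (cases "i \<in> K") (auto simp: K_def)
    \<comment> \<open>Since \<open>r \<ge> 1\<close>, some index lies outside \<open>J\<close>.
      Averaging over that fresh point yields measurability of the error from measurability of the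
      mislabeling event.\<close>
    have "card K > 0"
      using m r cardK by simp
    then obtain i where i: "i \<in> K"
      by (metis card_gt_0_iff all_not_in_conv)
    have i': "i \<in> {1..m}" "i \<notin> J"
      using i by (auto simp: K_def)
    have upd: "C J (\<delta>(i := y)) = C J \<delta>" for \<delta> y
      using i' J' by (intro C_cong) auto
    have [measurable]: "(\<lambda>\<delta>. prob (C J \<delta>)) \<in> borel_measurable (mprod M m)"
      by (rule borel_measurable_prob_of_mem[OF i'(1) _ hit[OF i'(1)] upd]) (auto simp: C_def)
    have [measurable]: "(\<lambda>\<delta>. card {j \<in> K. \<delta> j \<in> C J \<delta>}) \<in> measurable (mprod M m) (count_space UNIV)"
      by (rule measurable_card[OF hits])
    show B_sets: "B m \<epsilon> J \<in> sets (mprod M m)"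
      unfolding B_def K_def[symmetric] by measurable
    have C_events: "C J \<delta> \<in> events" if "\<delta> \<in> space (mprod M m)" for \<delta>
      unfolding C_def using G labeled_in_samples[OF that J, of T] T by (intro sets_mislabels) auto
    have "measure (PiM (J \<union> K) (\<lambda>_. M)) {\<delta> \<in> space (PiM (J \<union> K) (\<lambda>_. M)).
        \<epsilon> < prob (C J \<delta>) \<and> card {i \<in> K. \<delta> i \<in> C J \<delta>} < Suc r} \<le> binom_tail (card K) (Suc r) \<epsilon>"
    proof (rule measure_PiM_few_hits_le_binom_tail[OF J'(2) JK(3,2)])
      show "C J x = C J y" if "\<And>j. j \<in> J \<Longrightarrow> x j = y j" for x y
        using J'(2) that by (rule C_cong)
    qed (use \<epsilon> C_events B_sets in \<open>simp_all only: JK(1) B_def K_def[symmetric] less_imp_le\<close>)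
    then show "measure (mprod M m) (B m \<epsilon> J) \<le> binom_tail (m - d) (Suc r) \<epsilon>"
      unfolding JK(1) cardK B_def K_def[symmetric] .
  qed

  \<comment> \<open>The set \<open>J\<close> selected by \<open>mbar\<close> depends on the whole
    sample, so failure is covered by the bad events of all fixed \<open>J\<close>. The inclusion is
    only almost sure, because the existence of suitable index sets is.\<close>
  have fail_B: "AE \<delta> in mprod M m. err M T (A m (labeled T \<delta> {1..m})) > \<epsilon> \<longrightarrow> (\<exists>J \<in> nsets {1..m} d. \<delta> \<in> B m \<epsilon> J)"
    if m: "m \<ge> d + r" for m \<epsilon>
    using cond2[OF m] cond3[OF m] AE_space
  proof (eventually_elim, intro impI)
    fix \<delta>
    assume ex_cons: "\<forall>I \<in> nsets {1..m} r. \<exists>J \<in> nsets ({1..m} - I) d.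
        consistent (G (labeled T \<delta> J)) (labeled T \<delta> ({1..m} - I))"
      and ex_rem: "\<exists>I \<in> nsets {1..m} r. removable G T d m \<delta> I"
      and \<delta>: "\<delta> \<in> space (mprod M m)"
      and fail: "err M T (A m (labeled T \<delta> {1..m})) > \<epsilon>"
    define I where "I = Ibar m (labeled T \<delta> {1..m})"
    define J where "J = mbar m (labeled T \<delta> {1..m})"
    have I: "I \<in> nsets {1..m} r" "removable G T d m \<delta> I"
      using Ibar m \<delta> ex_rem by (auto simp: removal_choice_def I_def)
    have J: "J \<in> nsets ({1..m} - I) d"
      "(\<exists>J \<in> nsets ({1..m} - I) d. selects G T m \<delta> I J) \<Longrightarrow> selects G T m \<delta> I J"
      using mbar m \<delta> by (auto simp: compression_choice_def I_def J_def Let_def)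
    \<comment> \<open>\<open>mbar\<close> keeps its promise only where it can be met. A consistent
      \<open>J0\<close> exists by \<open>ex_cons\<close>, and removability of \<open>I\<close> makes
      its hypothesis mislabel all of \<open>I\<close>, so \<open>J0\<close> shows that the promise
      can be met.\<close>
    obtain J0 where "J0 \<in> nsets ({1..m} - I) d" "consistent (G (labeled T \<delta> J0)) (labeled T \<delta> ({1..m} - I))"
      using ex_cons I by blast
    then have "selects G T m \<delta> I J"
      using I(2) by (intro J(2)) (auto simp: removable_def selects_def)
    \<comment> \<open>Consistency outside \<open>I\<close> confines all mislabeled sample points to
      \<open>I\<close>, which has \<open>r\<close> elements.\<close>
    then have "{i \<in> {1..m} - J. \<delta> i \<in> C J \<delta>} \<subseteq> I"
      using \<delta> by (auto simp: selects_def consistent_labeled_iff C_iff)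
    then have "card {i \<in> {1..m} - J. \<delta> i \<in> C J \<delta>} \<le> card I"
      using I(1) by (intro card_mono) (auto simp: nsets_def)
    moreover have "\<epsilon> < prob (C J \<delta>)"
      using fail A_eq[OF m \<delta>] by (simp add: err_def C_def J_def)
    ultimately have "\<delta> \<in> B m \<epsilon> J"
      using I(1) \<delta> by (auto simp: B_def nsets_def)
    then show "\<exists>J \<in> nsets {1..m} d. \<delta> \<in> B m \<epsilon> J"
      using J(1) nsets_mono[of "{1..m} - I" "{1..m}" d] by blast
  qed

  have bound: "measure (mprod M m) {\<delta> \<in> space (mprod M m). err M T (A m (labeled T \<delta> {1..m})) > \<epsilon>}
      \<le> real (m choose d) * binom_tail (m - d) (Suc r) \<epsilon>" (is "measure _ ?F \<le> _")
    if m: "m \<ge> d + r" and \<epsilon>: "0 < \<epsilon>" "\<epsilon> < 1" for m \<epsilon>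
  proof -
    interpret Pm: prob_space "mprod M m"
      by (intro prob_space_PiM prob_space_axioms)
    have fin: "finite (nsets {1..m} d)"
      by (simp add: finite_imp_finite_nsets)
    \<comment> \<open>Union bound over all \<open>m choose d\<close> candidate sets; monotonicity is
      used in its almost-everywhere form.\<close>
    have "Pm.prob ?F \<le> Pm.prob (\<Union>J \<in> nsets {1..m} d. B m \<epsilon> J)"
      using fail_B[OF m, of \<epsilon>] fin B_sets[OF m _ \<epsilon>]
      by (intro Pm.finite_measure_mono_AE sets.finite_UN) auto
    also have "\<dots> \<le> (\<Sum>J \<in> nsets {1..m} d. Pm.prob (B m \<epsilon> J))"
      using fin B_sets[OF m _ \<epsilon>] by (intro Pm.finite_measure_subadditive_finite) auto
    also have "\<dots> \<le> (\<Sum>J \<in> nsets {1..m} d. binom_tail (m - d) (Suc r) \<epsilon>)"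
      using B_le[OF m _ \<epsilon>] by (intro sum_mono)
    also have "\<dots> = real (m choose d) * binom_tail (m - d) (Suc r) \<epsilon>"
      by (simp add: card_nsets)
    finally show ?thesis .
  qed

  show ?thesis
    unfolding PAC_T_def q_eq
    by (intro conjI allI impI)
      (simp_all only: A meas_failure bound choose_mult_binom_tail_tendsto_0)
qed

end
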